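(* Let $P$ be a finite set of points in the plane, no three of which are collinear, such that $$|P'| - |CH(P')| \;\geq\; |CH(P)| - \max|T_c'|.$$ Then (1) $|P'| \geq |CH(P)|$; and (2) for every set $S$ of consecutive points on $CH(P)$, the set $Q = P\setminus S$ satisfies $|CH(Q)| \leq |P'|+1$.
   Context: $CH(X)$ denotes the convex hull (boundary polygon) of a finite planar point set $X$; $|CH(X)|$ is the number of points of $X$ that are vertices of it. $P'$ is the set of points of $P$ lying in the interior of $CH(P)$. A set of consecutive points on $CH(P)$ is a set of vertices of $CH(P)$ that appear contiguously in the cyclic order along the boundary of $CH(P)$. An inward triangle is a triangle $abc$ where $bc$ is an edge of $CH(P)$, $a\in P'$, and no point of $P$ lies in the interior of the triangle; $a$ is called its inward vertex. For two points $p_r,p_t$ that are vertices of $CH(P)$, let $S_{rt}$ be the set of vertices of $CH(P)$ strictly between $p_r$ and $p_t$ on the counterclockwise boundary of $CH(P)$ from $p_r$ to $p_t$, let $Q_{rt}=P\setminus S_{rt}$, and let $qchain_{cc}(p_r,p_t)$ be the set of points on the counterclockwise boundary of $CH(Q_{rt})$ from $p_r$ to $p_t$, excluding $p_r$ and $p_t$. An inward triangle $abc$ with base edge $bc$ is forbidden if, for some $p_r,p_t$, $bc$ is an edge of the clockwise boundary of $CH(P)$ from $p_r$ to $p_t$ and $a\in qchain_{cc}(p_r,p_t)$. A set $T_c$ of non-forbidden inward triangles is compatible if no two triangles in $T_c$ share an edge, an inward vertex, or an interior point; it is maximal if no inward triangle can be added to it while keeping it compatible. For such $T_c$, $T_c'\subseteq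 T_c$ is the set of triangles in $T_c$ whose inward vertices are vertices of $CH(P')$. $\max|T_c'|$ denotes the maximum of $|T_c'|$ over all maximal compatible sets $T_c$. *)

theory Defs
  imports "HOL-Analysis.Analysis"
begin

type_synonym point = "real ^ 2"

definition no_three_collinear :: "point set \<Rightarrow> bool" where
  "no_three_collinear P \<longleftrightarrow>
     (\<forall>x\<in>P. \<forall>y\<in>P. \<forall>z\<in>P. x \<noteq> y \<and> y \<noteq> z \<and> x \<noteq> z \<longrightarrow> \<not> collinear {x, y, z})"

definition hull_vertices :: "point set \<Rightarrow> point set" where
  "hull_vertices X = {x \<in> X. x extreme_point_of (convex hull X)}"

definition interior_points :: "point set \<Rightarrow> point set" where
  "interior_points P = P \<inter> interior (convex hull P)"

(* Twice the signed area of the triangle pqr: positive iff r lies strictly to the left of the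
   directed line from p to q. *)
definition orient :: "point \<Rightarrow> point \<Rightarrow> point \<Rightarrow> real" where
  "orient p q r = (q $ 1 - p $ 1) * (r $ 2 - p $ 2) - (q $ 2 - p $ 2) * (r $ 1 - p $ 1)"

(* The segment bc is an edge of the hull polygon, and c follows b in counterclockwise order.
   If X has exactly two points, both directions are allowed: the boundary is then a
   degenerate polygon with two vertices. *)
definition ccw_edge :: "point set \<Rightarrow> point \<Rightarrow> point \<Rightarrow> bool" where
  "ccw_edge X b c \<longleftrightarrow>
     closed_segment b c edge_of (convex hull X) \<and> (\<forall>x\<in>X. 0 \<le> orient b c x)"

(* Vertices in the order in which they are met when moving counterclockwise along the boundary,
   with no vertex met twice. *)
definition ccw_walk :: "point set \<Rightarrow> point list \<Rightarrow> bool" where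
  "ccw_walk X vs \<longleftrightarrow>
     set vs \<subseteq> hull_vertices X \<and> distinct vs \<and> successively (ccw_edge X) vs"

definition cw_walk :: "point set \<Rightarrow> point list \<Rightarrow> bool" where
  "cw_walk X vs \<longleftrightarrow> ccw_walk X (rev vs)"

definition consecutive_on_hull :: "point set \<Rightarrow> point set \<Rightarrow> bool" where
  "consecutive_on_hull P S \<longleftrightarrow> (\<exists>vs. ccw_walk P vs \<and> S = set vs)"

definition ccw_between :: "point set \<Rightarrow> point \<Rightarrow> point \<Rightarrow> point set" where
  "ccw_between X p q = {v. \<exists>vs. ccw_walk X (p # vs @ [q]) \<and> v \<in> set vs}"

definition edge_on_cw_boundary ::
    "point set \<Rightarrow> point \<Rightarrow> point \<Rightarrow> point \<Rightarrow> point \<Rightarrow> bool" where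
  "edge_on_cw_boundary X p q b c \<longleftrightarrow>
     (\<exists>vs i. cw_walk X vs \<and> vs \<noteq> [] \<and> hd vs = p \<and> last vs = q \<and>
        Suc i < length vs \<and> {b, c} = {vs ! i, vs ! Suc i})"

definition qchain_cc :: "point set \<Rightarrow> point \<Rightarrow> point \<Rightarrow> point set" where
  "qchain_cc P p q = ccw_between (P - ccw_between P p q) p q"

(* A triple (a, b, c) stands for the triangle abc with inward vertex a and base edge bc. The
   base is listed in counterclockwise order, so that each inward triangle is represented by
   exactly one triple. *)
type_synonym triangle = "point \<times> point \<times> point"

fun inward_vertex :: "triangle \<Rightarrow> point" where
  "inward_vertex (a, b, c) = a"

fun triangle_edges :: "triangle \<Rightarrow> point set set" where
  "triangle_edges (a, b, c) = {{a, b}, {b, c}, {c, a}}"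

fun triangle_interior :: "triangle \<Rightarrow> point set" where
  "triangle_interior (a, b, c) = interior (convex hull {a, b, c})"

fun inward_triangle :: "point set \<Rightarrow> triangle \<Rightarrow> bool" where
  "inward_triangle P (a, b, c) \<longleftrightarrow>
     ccw_edge P b c \<and> a \<in> interior_points P \<and> P \<inter> triangle_interior (a, b, c) = {}"

fun forbidden :: "point set \<Rightarrow> triangle \<Rightarrow> bool" where
  "forbidden P (a, b, c) \<longleftrightarrow>
     (\<exists>p\<in>hull_vertices P. \<exists>q\<in>hull_vertices P. p \<noteq> q \<and>
        edge_on_cw_boundary P p q b c \<and> a \<in> qchain_cc P p q)"

definition compatible :: "point set \<Rightarrow> triangle set \<Rightarrow> bool" where
  "compatible P T \<longleftrightarrow>
     (\<forall>t\<in>T. inward_triangle P t \<and> \<not> forbidden P t) \<and>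
     (\<forall>s\<in>T. \<forall>t\<in>T. s \<noteq> t \<longrightarrow>
        triangle_edges s \<inter> triangle_edges t = {} \<and>
        inward_vertex s \<noteq> inward_vertex t \<and>
        triangle_interior s \<inter> triangle_interior t = {})"

definition maximal_compatible :: "point set \<Rightarrow> triangle set \<Rightarrow> bool" where
  "maximal_compatible P T \<longleftrightarrow>
     compatible P T \<and>
     (\<forall>t. inward_triangle P t \<and> t \<notin> T \<longrightarrow> \<not> compatible P (insert t T))"

(* The members of T whose inward vertices are vertices of the second convex layer of P. *)
definition layer_triangles :: "point set \<Rightarrow> triangle set \<Rightarrow> triangle set" where
  "layer_triangles P T = {t \<in> T. inward_vertex t \<in> hull_vertices (interior_points P)}"

(* For finite P the maximum ranges over a finite nonempty set of numbers. *)
definition max_layer_triangles :: "point set \<Rightarrow> nat" where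
  "max_layer_triangles P = Max {card (layer_triangles P T) | T. maximal_compatible P T}"

end

(* Remove a run S of s hull vertices, lying between the hull vertices p and q. The hull of P - S
   keeps the other vertices of CH(P) and gains a set N of points of P', which all lie on the new
   chain from p to q and are vertices of CH(P'). Take T_c attaining the maximum. A triangle of
   T_c' has its base either among the s + 1 edges of CH(P) on the removed side, or on the
   clockwise boundary from p to q; in the latter case it is not forbidden, so its inward vertex is
   a vertex of CH(P') outside N. As bases and inward vertices are not shared,
   |T_c'| <= s + 1 + |CH(P')| - |N|, and the hypothesis turns this into the bound on
   |CH(P - S)| = |CH(P)| - s + |N|.

   The cyclic order of the hull vertices comes from sorting them by angle around one of them. *)
theory Submission
  imports Defs
begin

section \<open>Signed area and collinearity\<close>

lemma orient_rotate: "orient q r p = orient p q r"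
  and orient_swap: "orient p r q = - orient p q r"
  by (simp_all add: orient_def algebra_simps)

text \<open>The vector is \<open>c - b\<close> turned left by a right angle, so for distinct
  \<open>b\<close> and \<open>c\<close> the sign of \<open>orient\<close> describes a half-plane
  with this inward normal.\<close>

lemma orient_eq_inner: "orient b c x = vector [b$2 - c$2, c$1 - b$1] \<bullet> (x - b)"
  by (simp add: orient_def inner_vec_def sum_2 algebra_simps)

lemma orient_zero_imp_collinear:
  assumes "orient b c x = 0"
  shows "collinear {b, c, x}"
proof (cases "b = c")
  case False
  let ?d = "c - b"
  have d: "?d $ 1 \<noteq> 0 \<or> ?d $ 2 \<noteq> 0"
    using False by (auto simp: vec_eq_iff forall_2)
  define t where "t = (if ?d $ 1 \<noteq> 0 then (x - b) $ 1 / ?d $ 1 else (x - b) $ 2 / ?d $ 2)"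
  have "x - b = t *\<^sub>R ?d"
    using d assms unfolding t_def orient_def vec_eq_iff forall_2
    by (auto simp: field_simps)
  then have "x = (1 - t) *\<^sub>R b + t *\<^sub>R c"
    by (simp add: algebra_simps)
  then have "\<exists>u. x = u *\<^sub>R b + (1 - u) *\<^sub>R c"
    by (intro exI[of _ "1 - t"]) simp
  then have "collinear {b, x, c}"
    using collinear_3_expand by blast
  then show ?thesis
    by (simp add: insert_commute)
qed simp

lemma no_three_collinear_orient:
  assumes "no_three_collinear X" "x \<in> X" "y \<in> X" "z \<in> X" "x \<noteq> y" "y \<noteq> z" "x \<noteq> z"
  shows "orient x y z \<noteq> 0"
  using assms orient_zero_imp_collinear unfolding no_three_collinear_def by blast

lemma no_three_collinear_subset:
  "no_three_collinear X \<Longrightarrow> Y \<subseteq> X \<Longrightarrow> no_three_collinear Y"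
  unfolding no_three_collinear_def by blast

text \<open>In the plane, two vectors orthogonal to a nonzero \<open>a\<close> are parallel, and
  \<open>orient x y z\<close> is the determinant of \<open>y - x\<close> and
  \<open>z - x\<close>.\<close>

lemma inner_eq_imp_orient_zero:
  fixes a :: point
  assumes "a \<noteq> 0" "a \<bullet> y = a \<bullet> x" "a \<bullet> z = a \<bullet> x"
  shows "orient x y z = 0"
proof -
  have e: "a$1 * (y$1 - x$1) + a$2 * (y$2 - x$2) = 0"
          "a$1 * (z$1 - x$1) + a$2 * (z$2 - x$2) = 0"
    using assms(2,3) by (simp_all add: inner_vec_def sum_2 algebra_simps)
  have "a$1 * orient x y z = 0" "a$2 * orient x y z = 0"
    using e unfolding orient_def by algebra+
  then show ?thesis
    using assms(1) by (auto simp: vec_eq_iff forall_2)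
qed

section \<open>Vertices and faces of the hull in general position\<close>

text \<open>A supporting line cuts out a face that is the hull of some points of \<open>X\<close>,
  and general position leaves only \<open>x\<close> and \<open>y\<close> on that line.\<close>

lemma supporting_segment_face_of:
  fixes a :: point
  assumes "finite X" "no_three_collinear X" "a \<noteq> 0"
    and x: "x \<in> X" and y: "y \<in> X" "y \<noteq> x" "a \<bullet> y = a \<bullet> x"
    and ge: "\<And>z. z \<in> X \<Longrightarrow> a \<bullet> x \<le> a \<bullet> z"
  shows "closed_segment x y face_of convex hull X"
proof -
  let ?F = "convex hull X \<inter> {z. a \<bullet> z = a \<bullet> x}"
  have "convex hull X \<subseteq> {z. a \<bullet> x \<le> a \<bullet> z}"
    by (rule hull_minimal) (use ge in \<open>auto simp: convex_halfspace_ge\<close>)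
  then have F: "?F face_of convex hull X"
    by (intro face_of_Int_supporting_hyperplane_ge) auto
  then obtain T where T: "T \<subseteq> X" "?F = convex hull T"
    using face_of_convex_hull_subset[OF finite_imp_compact[OF assms(1)]] by metis
  have "T \<subseteq> {x, y}"
  proof
    fix z assume "z \<in> T"
    then have "z \<in> X" "z \<in> ?F" using T hull_subset[of T convex] by auto
    then show "z \<in> {x, y}"
      using inner_eq_imp_orient_zero[OF assms(3) y(3), of z]
        no_three_collinear_orient[OF assms(2) x y(1)] y(2) by auto
  qed
  then have "?F \<subseteq> closed_segment x y"
    unfolding T(2) segment_convex_hull by (rule hull_mono)
  moreover have "closed_segment x y \<subseteq> ?F"
    by (rule closed_segment_subset)
      (use x y in \<open>auto simp: hull_inc intro!: convex_Int convex_hyperplane\<close>)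
  ultimately show ?thesis using F by simp
qed

text \<open>Otherwise deleting \<open>x\<close> leaves the hull unchanged, while every extreme point
  of the hull of \<open>X - {x}\<close> belongs to \<open>X - {x}\<close>.\<close>

lemma hull_vertex_in_convex_hull_subset:
  assumes "x \<in> hull_vertices X" "Y \<subseteq> X" "x \<in> convex hull Y"
  shows "x \<in> Y"
proof (rule ccontr)
  assume "x \<notin> Y"
  then have "Y \<subseteq> X - {x}" using assms(2) by auto
  then have x: "x \<in> convex hull (X - {x})" using assms(3) hull_mono by blast
  have "convex hull X = convex hull (X - {x})"
    using hull_redundant[OF x] assms(1) unfolding hull_vertices_def by (simp add: insert_absorb)
  then show False
    using assms(1) extreme_point_of_convex_hull[of x "X - {x}"] by (simp add: hull_vertices_def)
qed

lemma hull_vertices_subset: "hull_vertices X \<subseteq> X"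
  by (auto simp: hull_vertices_def)

lemma finite_hull_vertices: "finite X \<Longrightarrow> finite (hull_vertices X)"
  using hull_vertices_subset finite_subset by blast

lemma finite_interior_points: "finite X \<Longrightarrow> finite (interior_points X)"
  by (simp add: interior_points_def)

lemma hull_vertices_mono:
  assumes "Y \<subseteq> X"
  shows "hull_vertices X \<inter> Y \<subseteq> hull_vertices Y"
proof
  fix x assume "x \<in> hull_vertices X \<inter> Y"
  then have "x extreme_point_of convex hull X" "x \<in> convex hull Y" "x \<in> Y"
    by (auto simp: hull_vertices_def hull_inc)
  then show "x \<in> hull_vertices Y"
    using hull_mono[OF assms, of convex] unfolding hull_vertices_def extreme_point_of_def by auto
qed

lemma hull_vertices_not_interior: "hull_vertices X \<inter> interior_points X = {}"
  using extreme_point_not_in_interior unfolding hull_vertices_def interior_points_def by blast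

text \<open>A supporting line at \<open>x\<close> either contains a second point \<open>y\<close>,
  and then \<open>x\<close> is an end of the face from \<open>x\<close> to \<open>y\<close>, or has
  all other points strictly on one side, and then \<open>x\<close> is outside their hull.\<close>

lemma hull_vertex_or_interior:
  assumes "finite X" "no_three_collinear X" "x \<in> X" "x \<notin> interior_points X"
  shows "x \<in> hull_vertices X"
proof -
  have xh: "x \<in> convex hull X" by (simp add: assms(3) hull_inc)
  obtain a where a: "a \<noteq> 0" "\<And>z. z \<in> convex hull X \<Longrightarrow> a \<bullet> x \<le> a \<bullet> z"
  proof (cases "interior (convex hull X) = {}")
    \<comment> \<open>A hull without interior lies in a line, so the normal of that line supports it
      at \<open>x\<close> with equality throughout.\<close>
    case True
    then obtain a d where "a \<noteq> 0" "convex hull X \<subseteq> {z. a \<bullet> z = d}"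
      using empty_interior_subset_hyperplane convex_convex_hull by blast
    moreover from this have "a \<bullet> z = a \<bullet> x" if "z \<in> convex hull X" for z
      using xh that by blast
    ultimately show ?thesis using that[of a] by simp
  next
    case False
    then have "x \<notin> rel_interior (convex hull X)"
      using assms(3,4) rel_interior_nonempty_interior by (auto simp: interior_points_def)
    then show ?thesis
      by (rule supporting_hyperplane_rel_boundary[OF convex_convex_hull xh]) (rule that)
  qed
  have ge: "a \<bullet> x \<le> a \<bullet> z" if "z \<in> X" for z
    using a(2) that by (simp add: hull_inc)
  show ?thesis
  proof (cases "\<exists>y\<in>X. y \<noteq> x \<and> a \<bullet> y = a \<bullet> x")
    case True
    then obtain y where "y \<in> X" "y \<noteq> x" "a \<bullet> y = a \<bullet> x" by auto
    from supporting_segment_face_of[OF assms(1,2) a(1) assms(3) this ge]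
    have "closed_segment x y face_of convex hull X" .
    then have "x extreme_point_of convex hull X"
      using extreme_point_of_face extreme_point_of_segment by blast
    then show ?thesis using assms(3) by (simp add: hull_vertices_def)
  next
    case False
    then have *: "convex hull (X - {x}) \<subseteq> {z. a \<bullet> x < a \<bullet> z}"
      using ge by (intro hull_minimal)
        (auto simp: order_less_le convex_halfspace_gt[unfolded order_less_le])
    then have "x \<notin> convex hull (X - {x})" by auto
    then have "x extreme_point_of convex hull (insert x (X - {x}))"
      using assms(1) by (intro extreme_point_of_convex_hull_insert) auto
    then show ?thesis using assms(3) by (simp add: hull_vertices_def insert_absorb)
  qed
qed

lemma hull_vertices_Diff_layers:
  assumes "finite X" "no_three_collinear X"
  shows "hull_vertices (X - S) \<subseteq> (hull_vertices X - S) \<union> interior_points X"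
proof
  fix x assume "x \<in> hull_vertices (X - S)"
  then have "x \<in> X - S" using hull_vertices_subset by blast
  then show "x \<in> (hull_vertices X - S) \<union> interior_points X"
    using hull_vertex_or_interior[OF assms, of x] by blast
qed

section \<open>Counterclockwise edges and the cyclic order of the hull vertices\<close>

text \<open>The strict signs come from general position. Conversely, the signs say that the left
  normal of \<open>c - b\<close> attains its minimum over \<open>X\<close> at \<open>b\<close> and
  \<open>c\<close>, which gives a supporting segment.\<close>

lemma ccw_edge_iff:
  assumes "finite X" "no_three_collinear X"
  shows "ccw_edge X b c \<longleftrightarrow> b \<in> X \<and> c \<in> X \<and> b \<noteq> c \<and> (\<forall>x\<in>X - {b, c}. 0 < orient b c x)"
    (is "?L \<longleftrightarrow> ?R")
proof
  assume L: ?L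
  then have e: "closed_segment b c edge_of convex hull X" "\<And>x. x \<in> X \<Longrightarrow> 0 \<le> orient b c x"
    by (auto simp: ccw_edge_def)
  have "b extreme_point_of convex hull X" "c extreme_point_of convex hull X"
    using e(1) extreme_point_of_face extreme_point_of_segment unfolding edge_of_def by blast+
  then have bc: "b \<in> X" "c \<in> X" using extreme_point_of_convex_hull by blast+
  have "b \<noteq> c" using e(1) by (auto simp: edge_of_def)
  with bc e(2) no_three_collinear_orient[OF assms(2) bc] show ?R
    by (auto simp: order_less_le)
next
  assume R: ?R
  let ?a = "vector [b$2 - c$2, c$1 - b$1] :: point"
  have a0: "?a \<noteq> 0" using R by (auto simp: vec_eq_iff forall_2)
  have ge: "0 \<le> orient b c x" if "x \<in> X" for x
  proof (cases "x \<in> {b, c}")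
    case False
    then have "0 < orient b c x" using R that by blast
    then show ?thesis by simp
  qed (auto simp: orient_def)
  have "?a \<bullet> b \<le> ?a \<bullet> z" if "z \<in> X" for z
    using ge[OF that] unfolding orient_eq_inner by (simp add: inner_diff_right)
  moreover have "?a \<bullet> c = ?a \<bullet> b"
    by (simp add: inner_vec_def sum_2 algebra_simps)
  ultimately have "closed_segment b c face_of convex hull X"
    using R a0 by (intro supporting_segment_face_of[OF assms]) auto
  moreover have "aff_dim (closed_segment b c) = 1"
    using R by (simp add: segment_convex_hull aff_dim_convex_hull aff_dim_2)
  ultimately show ?L using ge by (simp add: ccw_edge_def edge_of_def)
qed

lemma ccw_edge_hull_vertices:
  assumes "ccw_edge X b c"
  shows "b \<in> hull_vertices X" "c \<in> hull_vertices X"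
proof -
  have "b extreme_point_of convex hull X" "c extreme_point_of convex hull X"
    using assms extreme_point_of_face extreme_point_of_segment
    unfolding edge_of_def ccw_edge_def by blast+
  then show "b \<in> hull_vertices X" "c \<in> hull_vertices X"
    using extreme_point_of_convex_hull by (auto simp: hull_vertices_def)
qed

text \<open>The sign condition ranges over all points of the set, so it survives deleting points
  other than the two ends.\<close>

lemma ccw_edge_subset:
  assumes "finite X" "no_three_collinear X" "Y \<subseteq> X" "b \<in> Y" "c \<in> Y" "ccw_edge X b c"
  shows "ccw_edge Y b c"
proof -
  have "finite Y" "no_three_collinear Y"
    using finite_subset[OF assms(3,1)] no_three_collinear_subset[OF assms(2,3)] by simp_all
  from ccw_edge_iff[OF this] show ?thesis
    using assms(3-6) unfolding ccw_edge_iff[OF assms(1,2)] by blast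
qed

text \<open>Of two successors of \<open>b\<close>, each would lie strictly to the left of the line
  from \<open>b\<close> to the other, but exchanging them changes the sign of
  \<open>orient\<close>.\<close>

lemma right_unique_ccw_edge:
  assumes "finite X" "no_three_collinear X"
  shows "right_unique (ccw_edge X)"
proof (rule right_uniqueI, rule ccontr)
  fix b c d assume "ccw_edge X b c" "ccw_edge X b d" "c \<noteq> d"
  then have "0 < orient b c d" "0 < orient b d c"
    by (auto simp: ccw_edge_iff[OF assms])
  then show False by (simp add: orient_def algebra_simps)
qed

text \<open>All other points lie strictly on one side of a line through the vertex \<open>x\<close>; the key is the
  slope relative to the normal of that line.\<close>

lemma hull_vertex_angle_key:
  assumes "finite X" "x \<in> hull_vertices X"
  obtains key :: "point \<Rightarrow> real"
  where "\<And>u v. u \<in> X - {x} \<Longrightarrow> v \<in> X - {x} \<Longrightarrow> key u < key v \<longleftrightarrow> 0 < orient x u v"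
proof -
  have "x \<notin> convex hull (X - {x})"
    using hull_vertex_in_convex_hull_subset[OF assms(2), of "X - {x}"] by auto
  moreover have "closed (convex hull (X - {x}))"
    using assms(1) by (simp add: compact_convex_hull compact_imp_closed finite_imp_compact)
  ultimately obtain a d where ad: "a \<bullet> x < d" "\<And>y. y \<in> convex hull (X - {x}) \<Longrightarrow> d < a \<bullet> y"
    using separating_hyperplane_closed_point[of "convex hull (X - {x})" x] by auto
  define f where "f y = a \<bullet> (y - x)" for y
  define g where "g y = a$1 * (y - x)$2 - a$2 * (y - x)$1" for y
  have f: "0 < f y" if "y \<in> X - {x}" for y
    using ad(1) ad(2)[OF hull_inc[OF that]] by (simp add: f_def inner_diff_right)
  show ?thesis
  proof
    fix u v assume uv: "u \<in> X - {x}" "v \<in> X - {x}"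
    have "a \<noteq> 0" using f[OF uv(1)] by (auto simp: f_def)
    then have pos: "0 < a \<bullet> a" by simp
    \<comment> \<open>\<open>f\<close> and \<open>g\<close> are coordinates along \<open>a\<close>
      and its left normal; both axes are scaled by the length of \<open>a\<close>, hence the factor
      \<open>a \<bullet> a\<close>.\<close>
    have "g v * f u - g u * f v = (a \<bullet> a) * orient x u v"
      unfolding f_def g_def orient_def inner_vec_def sum_2 inner_real_def vector_minus_component
      by algebra
    then have "g u * f v < g v * f u \<longleftrightarrow> 0 < orient x u v"
      using pos by (metis diff_gt_0_iff_gt zero_less_mult_pos mult_pos_pos)
    then show "g u / f u < g v / f v \<longleftrightarrow> 0 < orient x u v"
      using f[OF uv(1)] f[OF uv(2)] by (simp add: field_simps)
  qed
qed

text \<open>The successor is the first point in the angular order around \<open>b\<close>; general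
  position excludes ties.\<close>

lemma ex_ccw_edge:
  assumes "finite X" "no_three_collinear X" "b \<in> hull_vertices X" "X \<noteq> {b}"
  obtains c where "ccw_edge X b c"
proof -
  have bX: "b \<in> X" using assms(3) hull_vertices_subset by blast
  obtain key :: "point \<Rightarrow> real"
    where key: "\<And>u v. u \<in> X - {b} \<Longrightarrow> v \<in> X - {b} \<Longrightarrow> key u < key v \<longleftrightarrow> 0 < orient b u v"
    using hull_vertex_angle_key[OF assms(1,3)] by blast
  define c where "c = arg_min_on key (X - {b})"
  have "X - {b} \<noteq> {}" using bX assms(4) by auto
  then have c: "c \<in> X - {b}" "\<And>y. y \<in> X - {b} \<Longrightarrow> key c \<le> key y"
    unfolding c_def using assms(1)
    by (simp_all add: arg_min_if_finite(1) arg_min_least del: Diff_iff)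
  have "0 < orient b c x" if x: "x \<in> X - {b, c}" for x
  proof -
    have "\<not> 0 < orient b x c" using key[of x c] c x by force
    moreover have "orient b x c = - orient b c x" by (rule orient_swap)
    moreover have "orient b c x \<noteq> 0"
      using no_three_collinear_orient[OF assms(2) bX, of c x] c x by auto
    ultimately show ?thesis by simp
  qed
  then have "ccw_edge X b c" using c bX by (auto simp: ccw_edge_iff[OF assms(1,2)])
  then show ?thesis by (rule that)
qed

text \<open>The three signed areas divided by their sum are the barycentric coordinates of
  \<open>x\<close>.\<close>

lemma in_triangle_orient:
  assumes "0 < orient a b x" "0 < orient b c x" "0 < orient c a x"
  shows "x \<in> convex hull {a, b, c}"
proof -
  let ?A = "orient b c x" and ?B = "orient c a x" and ?C = "orient a b x"
  let ?D = "?A + ?B + ?C"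
  have D: "0 < ?D" using assms by simp
  have "?D * x$i = ?A * a$i + ?B * b$i + ?C * c$i" for i
    using exhaust_2[of i] by (auto simp: orient_def algebra_simps)
  then have "x$i = (?A * a$i + ?B * b$i + ?C * c$i) / ?D" for i
    using D by (metis less_irrefl nonzero_mult_div_cancel_left)
  then have "x$i = ?A/?D * a$i + ?B/?D * b$i + ?C/?D * c$i" for i
    by (simp add: add_divide_distrib)
  then have "x = (?A/?D) *\<^sub>R a + (?B/?D) *\<^sub>R b + (?C/?D) *\<^sub>R c"
    by (simp add: vec_eq_iff)
  moreover have "?A/?D + ?B/?D + ?C/?D = 1"
    using D by (simp flip: add_divide_distrib)
  moreover have "0 \<le> ?A/?D" "0 \<le> ?B/?D" "0 \<le> ?C/?D" using D assms by simp_all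
  ultimately show ?thesis unfolding convex_hull_3 by blast
qed

lemma ex_sorted_key_list:
  fixes key :: "'a \<Rightarrow> 'b::linorder"
  assumes "finite A" "inj_on key A"
  obtains xs where "set xs = A" "sorted_wrt (\<lambda>u v. key u < key v) xs"
proof -
  obtain l where l: "set l = A" "distinct l" using finite_distinct_list[OF assms(1)] by blast
  let ?xs = "sort_key key l"
  have "sorted (map key ?xs)" "distinct (map key ?xs)"
    using l assms(2) by (auto simp: distinct_map)
  then have "sorted_wrt (\<lambda>u v. key u < key v) ?xs"
    by (metis strict_sorted_iff sorted_wrt_map)
  then show ?thesis using l that[of ?xs] by simp
qed

text \<open>If the edge leaving a vertex skipped the next vertex in angular order around \<open>b\<close>, the skipped
  vertex would lie in the triangle spanned by \<open>b\<close> and that edge, so it would not be extreme.\<close>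

lemma hull_cycle:
  assumes "finite X" "no_three_collinear X" "b \<in> hull_vertices X" "X \<noteq> {b}"
  obtains vs where "distinct (b # vs)" "set (b # vs) = hull_vertices X"
    "successively (ccw_edge X) (b # vs @ [b])"
proof -
  let ?V = "hull_vertices X"
  note edge = ccw_edge_iff[OF assms(1,2)]
  have VX: "?V \<subseteq> X" by (rule hull_vertices_subset)
  obtain key :: "point \<Rightarrow> real"
    where key: "\<And>u v. u \<in> X - {b} \<Longrightarrow> v \<in> X - {b} \<Longrightarrow> key u < key v \<longleftrightarrow> 0 < orient b u v"
    using hull_vertex_angle_key[OF assms(1,3)] by blast
  have "inj_on key (?V - {b})"
  proof (rule inj_onI, rule ccontr)
    fix u v assume u: "u \<in> ?V - {b}" and v: "v \<in> ?V - {b}" and e: "key u = key v" "u \<noteq> v"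
    have "orient b v u = - orient b u v" by (rule orient_swap)
    moreover have "orient b u v \<noteq> 0"
      using no_three_collinear_orient[OF assms(2), of b u v] assms(3) u v e VX by auto
    ultimately show False using key[of u v] key[of v u] u v e subsetD[OF VX] by auto
  qed
  then obtain vs where vs: "set vs = ?V - {b}" "sorted_wrt (\<lambda>u v. key u < key v) vs"
    using ex_sorted_key_list finite_hull_vertices[OF assms(1)]
    by (metis finite_Diff)
  have dist: "distinct vs"
    using vs(2) by (simp add: distinct_conv_nth sorted_wrt_iff_nth_less)
      (metis less_irrefl linorder_neqE_nat)
  \<comment> \<open>\<open>b\<close> lies strictly to the left of every edge that avoids it, so such
    an edge increases the angular key.\<close>
  have step: "key u < key c" if "ccw_edge X u c" "u \<noteq> b" "c \<noteq> b" for u c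
  proof -
    have "0 < orient u c b" using that assms(3) VX edge by blast
    then show ?thesis using key[of u c] that edge orient_rotate by (metis DiffI singletonD)
  qed
  have "successively (ccw_edge X) (b # vs @ [b])"
  proof (unfold successively_conv_nth, intro allI impI)
    fix i assume i: "Suc i < length (b # vs @ [b])"
    define u where "u = (b # vs @ [b]) ! i"
    have iv: "(b # vs @ [b]) ! Suc i = (if i < length vs then vs ! i else b)"
      using i by (simp add: nth_append)
    have ui: "i = 0 \<and> u = b \<or> (\<exists>j. i = Suc j \<and> j < length vs \<and> u = vs ! j)"
      using i unfolding u_def by (cases i) (simp_all add: nth_append)
    have nth_vs: "vs ! m \<in> ?V - {b}" if "m < length vs" for m
      using vs(1) nth_mem[OF that] by simp
    have uV: "u \<in> ?V"
      using ui nth_vs assms(3) by blast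
    obtain c where c: "ccw_edge X u c"
      using ex_ccw_edge[OF assms(1,2) uV] assms(4) assms(3) VX uV
      by (metis singletonD subsetD)
    have cV: "c \<in> ?V" using ccw_edge_hull_vertices[OF c] by simp
    have cne: "c \<noteq> u" using c edge by auto
    have left: "0 < orient u c x" if "x \<in> ?V" "x \<noteq> u" "x \<noteq> c" for x
      using c that VX edge by blast
    have "c = (b # vs @ [b]) ! Suc i"
    proof (cases "c = b")
      case True
      then have ub: "u \<noteq> b" using cne by simp
      then obtain j where j: "i = Suc j" "j < length vs" "u = vs ! j"
        using ui by blast
      \<comment> \<open>A vertex still to come would lie to the left of the edge from
        \<open>u\<close> to \<open>b\<close>, hence before \<open>u\<close> in the angular
        order.\<close>
      have False if il: "i < length vs"
      proof -
        have v: "vs ! i \<in> ?V - {b}" and lt: "key u < key (vs ! i)"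
          using il vs(2) j nth_vs by (auto simp: sorted_wrt_iff_nth_less)
        have "0 < orient u b (vs ! i)"
          using left[of "vs ! i"] v lt True by auto
        then have "0 < orient b (vs ! i) u" by (simp only: orient_rotate[of b "vs ! i" u])
        then show False using key[of "vs ! i" u] v uV ub lt VX by auto
      qed
      then show ?thesis using iv True by auto
    next
      case False
      then obtain k where k: "k < length vs" "c = vs ! k" using cV vs(1)
        by (auto simp: in_set_conv_nth dest!: equalityD2 subsetD[of "?V - {b}" _ c])
      have mono: "key (vs ! m) < key (vs ! n) \<longleftrightarrow> m < n" if "m < length vs" "n < length vs" for m n
        using sorted_wrt_nth_less[OF vs(2)] that by (metis less_asym less_irrefl linorder_neqE_nat)
      \<comment> \<open>Edges away from \<open>b\<close> increase the key, so \<open>c\<close> comes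
        after \<open>u\<close> in the list; it remains to exclude a skipped vertex.\<close>
      have "i \<le> k"
      proof (cases "i = 0")
        case False
        then obtain j where j: "i = Suc j" "j < length vs" "u = vs ! j" using ui by blast
        then have "key (vs ! j) < key (vs ! k)"
          using step[OF c] nth_vs[OF j(2)] k(2) \<open>c \<noteq> b\<close> by simp
        then show ?thesis using mono[OF j(2) k(1)] j(1) by simp
      qed simp
      moreover have False if ik: "i < k"
      proof -
        let ?v = "vs ! i"
        have il: "i < length vs" using ik k by simp
        have v: "?v \<in> ?V - {b}" "key ?v < key c"
          using nth_vs[OF il] mono[OF il k(1)] ik k(2) by auto
        have v': "?v \<noteq> c" "?v \<noteq> u"
          using v ui nth_eq_iff_index_eq[OF dist] il by fastforce+
        have o1: "0 < orient b ?v c" using key[of ?v c] v cV False VX by auto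
        have o2: "0 < orient u c ?v" using left v(1) v' by blast
        show False
        proof (cases "u = b")
          case True
          \<comment> \<open>At \<open>u = b\<close> the triangle degenerates, but the two
            orientation facts already have opposite signs.\<close>
          then show False using o1 o2 by (simp add: orient_def algebra_simps)
        next
          case False
          then obtain j where j: "i = Suc j" "j < length vs" "u = vs ! j" using ui by auto
          have "0 < orient b u ?v"
            using key[of u ?v] mono[of j i] j il v uV False VX by auto
          moreover have "0 < orient c b ?v" using o1 by (simp only: orient_rotate[of c b ?v, symmetric] orient_rotate[of b ?v c])
          ultimately have "?v \<in> convex hull {b, u, c}" using in_triangle_orient o2 by blast
          then have "?v \<in> {b, u, c}"
            using hull_vertex_in_convex_hull_subset[of ?v X "{b, u, c}"]
              v assms(3) uV cV VX by auto
          then show False using v v' by auto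
        qed
      qed
      ultimately show ?thesis using k iv by (metis le_neq_implies_less)
    qed
    then show "ccw_edge X u ((b # vs @ [b]) ! Suc i)" using c by simp
  qed
  then show ?thesis using vs(1) dist assms(3) by (intro that[of vs]) auto
qed

section \<open>Uniqueness of boundary walks and the complement of a run\<close>

text \<open>Each step is forced by right-uniqueness, so of two walks with the same start the shorter
  begins the longer.\<close>

lemma successively_prefix:
  assumes "right_unique R"
    and "successively R (x # xs)" "successively R (x # ys)" "length xs \<le> length ys"
  shows "\<exists>zs. ys = xs @ zs"
  using assms(2-)
proof (induction xs arbitrary: x ys)
  case (Cons a xs)
  then obtain b ys' where ys: "ys = b # ys'" by (cases ys) auto
  then have "a = b" using Cons.prems right_uniqueD[OF assms(1), of x a b] by simp
  then show ?case using Cons.IH[of b ys'] Cons.prems ys by simp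
qed simp

text \<open>The shorter walk begins the longer, which cannot meet \<open>q\<close> before its end.
  Hence a single exhibited walk determines \<open>ccw_between\<close>.\<close>

lemma successively_distinct_unique:
  assumes R: "right_unique R"
    and "successively R (p # vs @ [q])" "successively R (p # ws @ [q])"
    and "distinct (p # vs @ [q])" "distinct (p # ws @ [q])"
  shows "vs = ws"
proof -
  have *: "xs = ys" if walks: "successively R (p # xs @ [q])" "successively R (p # ys @ [q])"
    "distinct (p # ys @ [q])" "length xs \<le> length ys" for xs ys
  proof -
    obtain zs where zs: "ys @ [q] = (xs @ [q]) @ zs"
      using successively_prefix[OF R walks(1,2)] walks(4) by auto
    have "zs = []"
    proof (rule ccontr)
      assume "zs \<noteq> []"
      then obtain zs' z where "zs = zs' @ [z]" by (cases zs rule: rev_cases) auto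
      then have "ys = xs @ q # zs'" using zs by simp
      then show False using walks(3) by simp
    qed
    then show ?thesis using zs by simp
  qed
  show ?thesis using *[of vs ws] *[of ws vs] assms by (cases "length vs \<le> length ws") auto
qed

text \<open>In the hull cycle started at the first vertex of \<open>S\<close>, the run comes first
  and the survivors follow as one walk. Its ends \<open>q\<close> and \<open>p\<close> are the
  neighbours of \<open>S\<close> after and before it; having two survivors keeps them
  distinct.\<close>

lemma consecutive_complement:
  assumes fin: "finite P" and ntc: "no_three_collinear P"
    and S: "consecutive_on_hull P S" "S \<noteq> {}"
    and two: "2 \<le> card (hull_vertices P - S)"
  obtains p q mid where "distinct (q # mid @ [p])" "set (q # mid @ [p]) = hull_vertices P - S"
    "successively (ccw_edge P) (q # mid @ [p])" "ccw_between P p q = S"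
proof -
  let ?V = "hull_vertices P"
  obtain w ws where ws: "ccw_walk P (w # ws)" "S = set (w # ws)"
    using S unfolding consecutive_on_hull_def by (metis list.exhaust set_empty2)
  have SV: "S \<subseteq> ?V" "distinct (w # ws)" "successively (ccw_edge P) (w # ws)"
    using ws by (auto simp: ccw_walk_def)
  have wV: "w \<in> ?V" using SV(1) ws(2) by auto
  have finV: "finite ?V" using fin by (rule finite_hull_vertices)
  have "P \<noteq> {w}"
  proof
    assume "P = {w}"
    then have "?V - S = {}" using hull_vertices_subset[of P] ws(2) by auto
    then have "card (?V - S) = 0" by (simp only: card.empty)
    then show False using two by linarith
  qed
  obtain us where us: "distinct (w # us)" "set (w # us) = ?V"
    "successively (ccw_edge P) (w # us @ [w])"
    by (rule hull_cycle[OF fin ntc wV \<open>P \<noteq> {w}\<close>])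
  have us': "successively (ccw_edge P) (w # us)"
    using us(3) by (metis append_Cons successively_append_iff)
  have "length (w # ws) \<le> length (w # us)"
    using card_mono[OF finV SV(1)] distinct_card[OF SV(2)] distinct_card[OF us(1)] us(2) ws(2)
    by simp
  then obtain rest where rest: "us = ws @ rest"
    using successively_prefix[OF right_unique_ccw_edge[OF fin ntc] SV(3) us'] by auto
  have setrest: "set rest = ?V - S" using us(1,2) rest ws(2) by auto
  have drest: "distinct rest" using us(1) rest by simp
  have "2 \<le> length rest" using two setrest distinct_card[OF drest] by simp
  then obtain q rest' where "rest = q # rest'" "rest' \<noteq> []"
    by (auto simp: numeral_2_eq_2 Suc_le_length_iff)
  then obtain mid p where rest_eq: "rest = q # mid @ [p]" by (metis rev_exhaust)
  have cyc: "successively (ccw_edge P) ((w # ws) @ (q # mid @ [p]) @ [w])"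
    using us(3) rest rest_eq by simp
  then have sr: "successively (ccw_edge P) (q # mid @ [p])"
    by (simp only: successively_append_iff)
  \<comment> \<open>The edge closing the cycle enters \<open>S\<close> from \<open>p\<close>, so
    \<open>p\<close>, the run and \<open>q\<close> form a walk.\<close>
  have pw: "ccw_edge P p w"
    using cyc successively_append_iff[of "ccw_edge P" "(w # ws) @ q # mid" "[p, w]"] by simp
  have "successively (ccw_edge P) ((w # ws) @ [q])"
    using cyc successively_append_iff[of "ccw_edge P" "(w # ws) @ [q]" "mid @ [p, w]"] by simp
  then have path: "successively (ccw_edge P) (p # (w # ws) @ [q])"
    using pw by simp
  have dpath: "distinct (p # (w # ws) @ [q])" using us(1) rest rest_eq by auto
  have "set (p # (w # ws) @ [q]) \<subseteq> ?V" using us(2) rest rest_eq by auto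
  then have walk: "ccw_walk P (p # (w # ws) @ [q])"
    using path dpath by (simp add: ccw_walk_def)
  have "ccw_between P p q = set (w # ws)"
  proof (intro equalityI subsetI)
    fix v assume "v \<in> ccw_between P p q"
    then obtain vs where vs: "ccw_walk P (p # vs @ [q])" "v \<in> set vs"
      by (auto simp: ccw_between_def)
    have "vs = w # ws"
      by (rule successively_distinct_unique[OF right_unique_ccw_edge[OF fin ntc] _ path _ dpath])
        (use vs(1) in \<open>simp_all add: ccw_walk_def\<close>)
    then show "v \<in> set (w # ws)" using vs(2) by simp
  qed (use walk in \<open>unfold ccw_between_def, blast\<close>)
  then show ?thesis
    using that[of q mid p] drest setrest sr rest_eq ws(2) by simp
qed

text \<open>Edges of the surviving walk stay edges after deleting \<open>S\<close>, so the hull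
  cycle of \<open>P - S\<close> from \<open>q\<close> begins with that walk. What follows leads from
  \<open>p\<close> back to \<open>q\<close> and is the new chain.\<close>

lemma hull_vertices_Diff_subset:
  assumes fin: "finite P" and ntc: "no_three_collinear P"
    and path: "distinct (q # mid @ [p])" "set (q # mid @ [p]) = hull_vertices P - S"
      "successively (ccw_edge P) (q # mid @ [p])"
  shows "hull_vertices (P - S) \<subseteq> (hull_vertices P - S) \<union> ccw_between (P - S) p q"
proof -
  let ?Q = "P - S"
  let ?V = "hull_vertices ?Q"
  have finQ: "finite ?Q" and ntcQ: "no_three_collinear ?Q"
    using fin ntc no_three_collinear_subset by auto
  have VQ: "hull_vertices P - S \<subseteq> ?V"
    using hull_vertices_mono[of ?Q P] hull_vertices_subset[of P] by blast
  have qV: "q \<in> ?V" using VQ path(2) by auto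
  have "p \<in> ?Q" "p \<noteq> q" using path hull_vertices_subset[of P] by auto
  then have "?Q \<noteq> {q}" by auto
  obtain us where us: "distinct (q # us)" "set (q # us) = ?V"
    "successively (ccw_edge ?Q) (q # us @ [q])"
    by (rule hull_cycle[OF finQ ntcQ qV \<open>?Q \<noteq> {q}\<close>])
  have us': "successively (ccw_edge ?Q) (q # us)"
    using us(3) by (metis append_Cons successively_append_iff)
  have pathQ: "successively (ccw_edge ?Q) (q # mid @ [p])"
  proof (rule successively_mono[OF path(3)])
    fix x y assume "x \<in> set (q # mid @ [p])" "y \<in> set (q # mid @ [p])" "ccw_edge P x y"
    then show "ccw_edge ?Q x y"
      using ccw_edge_subset[OF fin ntc, of ?Q x y] path(2) hull_vertices_subset[of P] by auto
  qed
  have "length (q # mid @ [p]) \<le> length (q # us)"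
    using card_mono[OF finite_hull_vertices[OF finQ] VQ] path(2) us(2)
      distinct_card[OF path(1)] distinct_card[OF us(1)] by simp
  then obtain zs where zs: "us = (mid @ [p]) @ zs"
    using successively_prefix[OF right_unique_ccw_edge[OF finQ ntcQ] pathQ us'] by auto
  have "ccw_walk ?Q (p # zs @ [q])"
    unfolding ccw_walk_def
  proof (intro conjI)
    show "set (p # zs @ [q]) \<subseteq> ?V" "distinct (p # zs @ [q])"
      using us(1,2) zs by auto
    have "successively (ccw_edge ?Q) ((q # mid) @ (p # zs @ [q]))"
      using us(3) zs by simp
    then show "successively (ccw_edge ?Q) (p # zs @ [q])"
      by (simp only: successively_append_iff)
  qed
  then have "set zs \<subseteq> ccw_between ?Q p q" by (auto simp: ccw_between_def)
  then show ?thesis using us(2) zs path(2) by auto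
qed

text \<open>The walk from \<open>q\<close> to \<open>p\<close> contains the outgoing edge of each of
  its vertices except the last, \<open>p\<close>. Read backwards, it is the clockwise boundary from
  \<open>p\<close> to \<open>q\<close>.\<close>

lemma edge_on_cw_boundaryI:
  assumes "finite P" "no_three_collinear P"
    and path: "distinct (q # mid @ [p])" "set (q # mid @ [p]) = hull_vertices P - S"
      "successively (ccw_edge P) (q # mid @ [p])"
    and bc: "ccw_edge P b c" "b \<notin> S" "b \<noteq> p"
  shows "edge_on_cw_boundary P p q b c"
proof -
  let ?L = "q # mid @ [p]"
  let ?n = "length ?L"
  have "b \<in> set (q # mid)"
    using path(2) bc ccw_edge_hull_vertices(1)[OF bc(1)] by auto
  then obtain i where "i < length (q # mid)" "(q # mid) ! i = b"
    by (metis in_set_conv_nth)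
  then have i: "Suc i < ?n" "?L ! i = b"
    by (simp_all add: nth_append flip: append_Cons)
  have "ccw_edge P (?L ! i) (?L ! Suc i)"
    using path(3) i(1) unfolding successively_conv_nth by blast
  then have c: "?L ! Suc i = c"
    using right_uniqueD[OF right_unique_ccw_edge[OF assms(1,2)] _ bc(1)] i(2) by simp
  define j where "j = ?n - Suc (Suc i)"
  have j: "Suc j < ?n" "?n - Suc j = Suc i" "?n - Suc (Suc j) = i"
    using i(1) by (auto simp: j_def)
  have "rev ?L ! j = c" "rev ?L ! Suc j = b"
    using rev_nth[of j ?L] rev_nth[of "Suc j" ?L] j i(2) c by (simp_all del: rev.simps append.simps)
  moreover have "cw_walk P (rev ?L)"
    using path unfolding cw_walk_def ccw_walk_def by auto
  moreover have "hd (rev ?L) = p" "last (rev ?L) = q" by (simp_all add: hd_rev last_rev)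
  ultimately show ?thesis
    unfolding edge_on_cw_boundary_def
    by (intro exI[of _ "rev ?L"] exI[of _ j]) (use j in auto)
qed

section \<open>Compatible sets of triangles\<close>

lemma compatible_subset:
  assumes "compatible P T"
  shows "T \<subseteq> P \<times> P \<times> P"
proof
  fix t assume t: "t \<in> T"
  obtain a b c where abc: "t = (a, b, c)" by (cases t)
  have "inward_triangle P (a, b, c)" using assms t abc unfolding compatible_def by blast
  then show "t \<in> P \<times> P \<times> P"
    using ccw_edge_hull_vertices[of P b c] hull_vertices_subset[of P] abc
    by (auto simp: interior_points_def)
qed

text \<open>The empty set is compatible and there are finitely many compatible sets, so an
  inclusion-maximal one exists. \<open>Max\<close> is thus taken over a finite nonempty set.\<close>

lemma max_layer_triangles_attained:
  assumes "finite P"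
  obtains T where "compatible P T" "card (layer_triangles P T) = max_layer_triangles P"
proof -
  have finC: "finite {T. compatible P T}"
  proof (rule finite_subset)
    show "{T. compatible P T} \<subseteq> Pow (P \<times> P \<times> P)" using compatible_subset by blast
  qed (use assms in simp)
  have "{} \<in> {T. compatible P T}" by (simp add: compatible_def)
  then obtain M where M: "compatible P M" "\<And>T. compatible P T \<Longrightarrow> M \<subseteq> T \<Longrightarrow> M = T"
    using finite_has_maximal[OF finC] by blast
  then have "maximal_compatible P M" unfolding maximal_compatible_def by blast
  moreover have "finite {T. maximal_compatible P T}"
    by (rule finite_subset[OF _ finC]) (auto simp: maximal_compatible_def)
  ultimately have "max_layer_triangles P \<in> {card (layer_triangles P T) | T. maximal_compatible P T}"
    unfolding max_layer_triangles_def by (intro Max_in) auto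
  then show ?thesis using that by (auto simp: maximal_compatible_def)
qed

section \<open>Counting hull vertices after a deletion\<close>

text \<open>Two estimates are added, one for the new hull and one for the triangles;
  \<open>card S\<close> and \<open>card N\<close> occur in both and cancel.\<close>

lemma card_hull_vertices_Diff_le:
  assumes fin: "finite P" and ntc: "no_three_collinear P"
    and T: "compatible P T"
    and S: "consecutive_on_hull P S" "S \<noteq> {}"
    and two: "2 \<le> card (hull_vertices P - S)"
  shows "card (hull_vertices (P - S)) + card (layer_triangles P T)
    \<le> card (hull_vertices P) + card (hull_vertices (interior_points P)) + 1"
proof -
  let ?V = "hull_vertices P" and ?I = "interior_points P"
  let ?T = "layer_triangles P T"
  obtain p q mid where path: "distinct (q # mid @ [p])" "set (q # mid @ [p]) = ?V - S"
    "successively (ccw_edge P) (q # mid @ [p])" and between: "ccw_between P p q = S"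
    by (rule consecutive_complement[OF fin ntc S two])
  have SV: "S \<subseteq> ?V" using S by (auto simp: consecutive_on_hull_def ccw_walk_def)
  have finV: "finite ?V" using fin by (rule finite_hull_vertices)
  have finS: "finite S" using SV finV by (rule finite_subset)
  define N where "N = hull_vertices (P - S) \<inter> ?I"
  \<comment> \<open>A vertex of the hull of \<open>P - S\<close> that lies in the subset of interior
    points is also a vertex of the hull of that subset.\<close>
  have NI: "N \<subseteq> hull_vertices ?I"
  proof -
    have "?I \<subseteq> P - S" using hull_vertices_not_interior[of P] SV by (auto simp: interior_points_def)
    then show ?thesis using hull_vertices_mono N_def by blast
  qed
  \<comment> \<open>Old vertices are not interior points, so \<open>N\<close> must lie on the new
    chain; since \<open>S\<close> is exactly what lies between \<open>p\<close> and
    \<open>q\<close>, this chain is \<open>qchain_cc P p q\<close>.\<close>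
  have Nq: "N \<subseteq> qchain_cc P p q"
    using hull_vertices_Diff_subset[OF fin ntc path] hull_vertices_not_interior[of P] between
    unfolding N_def qchain_cc_def by blast
  have finI: "finite (hull_vertices ?I)"
    by (intro finite_hull_vertices finite_interior_points fin)
  have finN: "finite N" using NI finI by (rule finite_subset)
  have "hull_vertices (P - S) \<subseteq> (?V - S) \<union> N"
    using hull_vertices_Diff_layers[OF fin ntc] unfolding N_def by blast
  then have "card (hull_vertices (P - S)) \<le> card ((?V - S) \<union> N)"
    using finV finN by (intro card_mono) auto
  also have "\<dots> \<le> card (?V - S) + card N" by (rule card_Un_le)
  finally have hull: "card (hull_vertices (P - S)) + card S \<le> card ?V + card N"
    using card_Diff_subset[OF finS SV] card_mono[OF finV SV] by linarith
  have finT: "finite ?T"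
    using finite_subset[OF compatible_subset[OF T]] fin by (simp add: layer_triangles_def)
  have tri: "ccw_edge P b c" "\<not> forbidden P (a, b, c)" "a \<in> hull_vertices ?I"
    if "(a, b, c) \<in> ?T" for a b c
  proof -
    have "inward_triangle P (a, b, c)" "\<not> forbidden P (a, b, c)"
      using that T unfolding compatible_def layer_triangles_def by blast+
    then show "ccw_edge P b c" "\<not> forbidden P (a, b, c)" "a \<in> hull_vertices ?I"
      using that by (auto simp: layer_triangles_def simp del: forbidden.simps)
  qed
  have sep: "s = t" if "s \<in> ?T" "t \<in> ?T"
    "inward_vertex s = inward_vertex t \<or> triangle_edges s \<inter> triangle_edges t \<noteq> {}" for s t
    using that T unfolding compatible_def layer_triangles_def by blast
  \<comment> \<open>A base is determined by its first end, and \<open>insert p S\<close> holds the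
    first ends of the \<open>card S + 1\<close> edges running from \<open>p\<close> through
    \<open>S\<close> to \<open>q\<close>.\<close>
  define A where "A = {t \<in> ?T. fst (snd t) \<in> insert p S}"
  have "inj_on (\<lambda>t. fst (snd t)) A"
  proof (rule inj_onI)
    fix s t assume st: "s \<in> A" "t \<in> A" "fst (snd s) = fst (snd t)"
    obtain a b c a' c' where e: "s = (a, b, c)" "t = (a', b, c')"
      using st(3) by (metis prod.collapse)
    have "c = c'"
      using st(1,2) e tri(1) right_uniqueD[OF right_unique_ccw_edge[OF fin ntc]]
      unfolding A_def by blast
    then show "s = t" using sep[of s t] st(1,2) e by (auto simp: A_def)
  qed
  moreover have "(\<lambda>t. fst (snd t)) ` A \<subseteq> insert p S" by (auto simp: A_def)
  ultimately have "card A \<le> card (insert p S)"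
    using finS by (intro card_inj_on_le) auto
  then have cA: "card A \<le> card S + 1"
    using card_insert_if[OF finS, of p] by (simp split: if_splits)
  have "inj_on inward_vertex (?T - A)"
    using sep by (auto simp: inj_on_def)
  moreover have "inward_vertex ` (?T - A) \<subseteq> hull_vertices ?I - N"
  proof (clarify)
    fix a b c assume t: "(a, b, c) \<in> ?T" "(a, b, c) \<notin> A"
    \<comment> \<open>The base starts at a survivor other than \<open>p\<close>, so an inward vertex
      on the new chain would make the triangle forbidden.\<close>
    have "edge_on_cw_boundary P p q b c"
      using edge_on_cw_boundaryI[OF fin ntc path tri(1)[OF t(1)]] t by (auto simp: A_def)
    moreover have "p \<in> ?V" "q \<in> ?V" "p \<noteq> q" using path by auto
    ultimately have "a \<notin> qchain_cc P p q" using tri(2)[OF t(1)] by auto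
    then show "inward_vertex (a, b, c) \<in> hull_vertices ?I - N"
      using Nq tri(3)[OF t(1)] by auto
  qed
  ultimately have "card (?T - A) \<le> card (hull_vertices ?I - N)"
    using finI by (intro card_inj_on_le) auto
  moreover have "card (hull_vertices ?I - N) + card N = card (hull_vertices ?I)"
    using card_Diff_subset[OF finN NI] card_mono[OF finI NI] by simp
  moreover have "card ?T = card A + card (?T - A)"
    using card_Un_disjoint[of A "?T - A"] finT by (auto simp: A_def Un_absorb1 intro: finite_subset)
  ultimately show ?thesis using hull cA by linarith
qed

text \<open>Distinct inward vertices bound the layer triangles by the vertices of the second layer,
  which gives the first claim. The hypothesis is in additive form to avoid truncated
  subtraction.\<close>

lemma layer_triangles_bounds:
  assumes fin: "finite P" and ntc: "no_three_collinear P"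
    and T: "compatible P T"
    and ge: "card (hull_vertices P) + card (hull_vertices (interior_points P))
      \<le> card (interior_points P) + card (layer_triangles P T)"
  shows "card (hull_vertices P) \<le> card (interior_points P)"
    and "consecutive_on_hull P S \<Longrightarrow>
      card (hull_vertices (P - S)) \<le> card (interior_points P) + 1"
proof -
  let ?V = "hull_vertices P" and ?I = "interior_points P"
  have finI: "finite ?I" "finite (hull_vertices ?I)"
    by (intro finite_hull_vertices finite_interior_points fin)+
  have "inj_on inward_vertex (layer_triangles P T)"
    using T unfolding compatible_def layer_triangles_def inj_on_def by blast
  then have "card (layer_triangles P T) \<le> card (hull_vertices ?I)"
    using finI by (intro card_inj_on_le) (auto simp: layer_triangles_def)
  then show V: "card ?V \<le> card ?I" using ge by linarith
  show "card (hull_vertices (P - S)) \<le> card ?I + 1" if S: "consecutive_on_hull P S"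
  proof -
    \<comment> \<open>The counting inequality covers a nonempty run with two survivors. The empty
      run is the first claim, and with at most one survivor every other vertex of the new hull is an
      interior point of \<open>P\<close>.\<close>
    consider "S = {}" | "card (?V - S) < 2" | "S \<noteq> {}" "2 \<le> card (?V - S)" by linarith
    then show ?thesis
    proof cases
      case 1
      then show ?thesis using V by simp
    next
      case 2
      have "hull_vertices (P - S) \<subseteq> (?V - S) \<union> ?I"
        by (rule hull_vertices_Diff_layers[OF fin ntc])
      then have "card (hull_vertices (P - S)) \<le> card ((?V - S) \<union> ?I)"
        using finI finite_hull_vertices[OF fin] by (intro card_mono) auto
      also have "\<dots> \<le> card (?V - S) + card ?I" by (rule card_Un_le)
      finally show ?thesis using 2 by linarith
    next
      case 3
      then show ?thesis
        using card_hull_vertices_Diff_le[OF fin ntc T S] ge by linarith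
    qed
  qed
qed

theorem lemma7:
  fixes P :: "point set"
  assumes "finite P"
    and "no_three_collinear P"
    and "int (card (interior_points P)) - int (card (hull_vertices (interior_points P)))
           \<ge> int (card (hull_vertices P)) - int (max_layer_triangles P)"
  shows "card (interior_points P) \<ge> card (hull_vertices P) \<and>
         (\<forall>S. consecutive_on_hull P S \<longrightarrow>
            card (hull_vertices (P - S)) \<le> card (interior_points P) + 1)"
proof -
  obtain T where T: "compatible P T" "card (layer_triangles P T) = max_layer_triangles P"
    by (rule max_layer_triangles_attained[OF assms(1)])
  have "card (hull_vertices P) + card (hull_vertices (interior_points P))
      \<le> card (interior_points P) + card (layer_triangles P T)"
    using assms(3) T(2) by linarith
  then show ?thesis
    using layer_triangles_bounds[OF assms(1,2) T(1)] by blast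
qed

end
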